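(* Let $P$ be a convex integral polytope in $\mathbb{R}^m$ such that $P\subset p\Sigma$ ($p$ a positive integer) and $P\not\subset\partial(p\Sigma)$. Then $$\frac1N\log\Pi_{|NP}(z,z)\to-b_P(z)\quad\text{as } N\to\infty$$ uniformly on all compact subsets of $(\mathbb{C}^* )^m$.
   Context: $\Sigma=\{x\in\mathbb{R}^m: x_j\ge 0,\ \sum_j x_j\le 1\}$; $\mathbb{C}^*=\mathbb{C}\setminus\{0\}$. A convex integral polytope is the convex hull of a finite set of points of $\mathbb{Z}^m$. $\mu(z)=\left(\frac{|z_1|^2}{1+\|z\|^2},\dots,\frac{|z_m|^2}{1+\|z\|^2}\right)$ on $(\mathbb{C}^* )^m$; $e^\tau\cdot z=(e^{\tau_1}z_1,\dots,e^{\tau_m}z_m)$ for $\tau\in\mathbb{R}^m$. For $x\in P$, $C_x=\{u\in\mathbb{R}^m:\langle u,x\rangle=\sup_{y\in P}\langle u,y\rangle\}$. For each $z\in(\mathbb{C}^* )^m$ there are unique $q(z)\in P$, $\tau_z\in C_{q(z)}$ with $p\mu(e^{-\tau_z/2}\cdot z)=q(z)$, and $b_P(z)=-\langle q(z),\tau_z\rangle+p\log\left(\frac{1+\|z\|^2}{1+\|e^{-\tau_z/2}\cdot z\|^2}\right)$. The conditional Szegő kernel on the diagonal is $\Pi_{|NP}(z,z)=\frac{(Np+m)!}{(Np)!}\,\frac{\sum_{\alpha\in NP\cap\mathbb{Z}^m}\binom{Np}{\alpha}|z^\alpha|^2}{(1+\|z\|^2)^{Np}}$, where $\binom{Np}{\alpha}=\frac{(Np)!}{(Np-|\alpha|)!\,\alpha_1!\cdots\alpha_m!}$.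 *)

theory Defs
  imports "HOL-Analysis.Analysis"
begin

definition real_of_int_vec :: "int ^ 'm \<Rightarrow> real ^ 'm" where
  "real_of_int_vec \<alpha> = (\<chi> i. real_of_int (\<alpha> $ i))"

definition integral_polytope :: "(real ^ 'm) set \<Rightarrow> bool" where
  "integral_polytope P \<longleftrightarrow>
     (\<exists>S :: (int ^ 'm) set. finite S \<and> P = convex hull (real_of_int_vec ` S))"

definition unit_simplex :: "(real ^ 'm) set" where
  "unit_simplex = {x. (\<forall>j. 0 \<le> x $ j) \<and> (\<Sum>j\<in>UNIV. x $ j) \<le> 1}"

definition dilate :: "nat \<Rightarrow> (real ^ 'm) set \<Rightarrow> (real ^ 'm) set" where
  "dilate k A = (\<lambda>x. real k *\<^sub>R x) ` A"

definition complex_torus :: "(complex ^ 'm) set" where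
  "complex_torus = {z. \<forall>j. z $ j \<noteq> 0}"

text \<open>The norm of \<^typ>\<open>complex ^ 'm\<close> is the Hermitian (Euclidean) one.\<close>

definition moment_map :: "complex ^ 'm \<Rightarrow> real ^ 'm" where
  "moment_map z = (\<chi> j. (cmod (z $ j))\<^sup>2 / (1 + (norm z)\<^sup>2))"

definition exp_act :: "real ^ 'm \<Rightarrow> complex ^ 'm \<Rightarrow> complex ^ 'm" where
  "exp_act \<tau> z = (\<chi> j. complex_of_real (exp (\<tau> $ j)) * z $ j)"

definition normal_cone :: "(real ^ 'm) set \<Rightarrow> real ^ 'm \<Rightarrow> (real ^ 'm) set" where
  "normal_cone P x = {u. u \<bullet> x = (SUP y\<in>P. u \<bullet> y)}"

text \<open>For \<open>z\<close> in the complex torus, \<open>(q(z), \<tau>\<^sub>z)\<close> is the unique pair with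
  \<open>q(z) \<in> P\<close>, \<open>\<tau>\<^sub>z\<close> in the normal cone of \<open>P\<close> at \<open>q(z)\<close> and
  \<open>p \<mu>(e\<^bsup>-\<tau>/2\<^esup> \<cdot> z) = q(z)\<close>. Existence and uniqueness hold when the integral polytope
  \<open>P\<close> lies in \<open>p \<Sigma>\<close> but not in its boundary; outside that situation the definite
  description below carries no information.\<close>

definition q_tau ::
  "(real ^ 'm) set \<Rightarrow> nat \<Rightarrow> complex ^ 'm \<Rightarrow> (real ^ 'm) \<times> (real ^ 'm)" where
  "q_tau P p z = (THE (q, \<tau>). q \<in> P \<and> \<tau> \<in> normal_cone P q \<and>
     real p *\<^sub>R moment_map (exp_act ((- 1 / 2) *\<^sub>R \<tau>) z) = q)"

definition q_point :: "(real ^ 'm) set \<Rightarrow> nat \<Rightarrow> complex ^ 'm \<Rightarrow> real ^ 'm" where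
  "q_point P p z = fst (q_tau P p z)"

definition tau :: "(real ^ 'm) set \<Rightarrow> nat \<Rightarrow> complex ^ 'm \<Rightarrow> real ^ 'm" where
  "tau P p z = snd (q_tau P p z)"

definition b_fun :: "(real ^ 'm) set \<Rightarrow> nat \<Rightarrow> complex ^ 'm \<Rightarrow> real" where
  "b_fun P p z = - (q_point P p z \<bullet> tau P p z) +
     real p * ln ((1 + (norm z)\<^sup>2) /
       (1 + (norm (exp_act ((- 1 / 2) *\<^sub>R tau P p z) z))\<^sup>2))"

text \<open>The conversions \<^const>\<open>nat\<close> are harmless for the intended use: if
  \<open>\<alpha> \<in> k \<Sigma>\<close>, then all \<open>\<alpha>\<^sub>j\<close> and \<open>k - |\<alpha>|\<close> are nonnegative.\<close>

definition multinomial :: "nat \<Rightarrow> int ^ 'm \<Rightarrow> real" where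
  "multinomial k \<alpha> =
     fact k / (fact (nat (int k - (\<Sum>j\<in>UNIV. \<alpha> $ j))) * (\<Prod>j\<in>UNIV. fact (nat (\<alpha> $ j))))"

definition monomial :: "complex ^ 'm \<Rightarrow> int ^ 'm \<Rightarrow> complex" where
  "monomial z \<alpha> = (\<Prod>j\<in>UNIV. (z $ j) powi (\<alpha> $ j))"

definition szego_diag :: "(real ^ 'm) set \<Rightarrow> nat \<Rightarrow> nat \<Rightarrow> complex ^ 'm \<Rightarrow> real" where
  "szego_diag P p N z =
     fact (N * p + CARD('m)) / fact (N * p) *
     ((\<Sum>\<alpha> | real_of_int_vec \<alpha> \<in> dilate N P.
         multinomial (N * p) \<alpha> * (cmod (monomial z \<alpha>))\<^sup>2) /
      (1 + (norm z)\<^sup>2) ^ (N * p))"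

end

theory Submission
  imports Defs
begin

text \<open>Put \<open>w\<^sub>0 = 1\<close>, \<open>w\<^sub>j = |z\<^sub>j|\<^sup>2\<close> and \<open>x\<^sub>0 = p - \<Sum>\<^sub>j x\<^sub>j\<close>; the index \<open>0\<close> is \<^const>\<open>None\<close> below.
  Among the points of \<open>P\<close>, \<open>q(z)\<close> is the maximizer of the concave function
  \<open>E(x) = \<Sum>\<^sub>i x\<^sub>i log (w\<^sub>i / x\<^sub>i)\<close>, with \<open>i = 0\<close> included in the sum. It has all \<open>q\<^sub>i > 0\<close> because \<open>E\<close> has
  infinite slope at the boundary of the simplex, \<open>\<tau>\<^sub>z\<close> is the gradient of \<open>E\<close> at \<open>q(z)\<close>, and
  \<open>-b\<^sub>P(z) = E(q(z)) + p log p - p log (1 + \<parallel>z\<parallel>\<^sup>2)\<close>.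

  Each term of the lattice sum is at most \<open>p\<^sup>N\<^sup>p exp (N E(q))\<close>: write \<open>w\<^sub>i = q\<^sub>i (w\<^sub>i / q\<^sub>i)\<close>, bound
  the \<open>q\<close>-part by the multinomial theorem and the rest by the first-order optimality of \<open>q\<close>. There are
  only polynomially many terms. Conversely, \<open>NP\<close> contains a lattice point within bounded distance of
  \<open>Nq\<close>, and by Stirling its term alone is \<open>exp (N (E(q) + p log p) + o(N))\<close>,
  uniformly while the \<open>log w\<^sub>i\<close> stay bounded.\<close>

section \<open>Maximizing the entropy over a convex set\<close>

text \<open>Only the point 0 is delicate: \<open>ln 0 = 0\<close> makes the value there 0, and
  substituting 1/x for x reduces the limit to that of ln x / x at infinity.\<close>

lemma continuous_on_times_ln: "continuous_on {0..} (\<lambda>x::real. x * ln x)"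
proof -
  have "((\<lambda>x::real. x * ln x) \<longlongrightarrow> 0) (at_right 0)"
    unfolding filterlim_at_right_to_top
  proof (rule Lim_transform_eventually)
    show "((\<lambda>x::real. - (ln x / x)) \<longlongrightarrow> 0) at_top"
      using tendsto_minus[OF ln_x_over_x_tendsto_0] by simp
    show "\<forall>\<^sub>F x::real in at_top. - (ln x / x) = inverse x * ln (inverse x)"
      using eventually_gt_at_top[of 0]
      by eventually_elim (simp add: ln_inverse divide_inverse)
  qed
  then have 0: "continuous (at 0 within {0..}) (\<lambda>x::real. x * ln x)"
    by (simp add: continuous_within at_within_Ici_at_right)
  have "continuous (at x within {0..}) (\<lambda>x. x * ln x)" if "0 < x" for x :: real
    using that by (intro continuous_intros) auto
  with 0 show ?thesis
    by (metis atLeast_iff continuous_on_eq_continuous_within order_le_less)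
qed

text \<open>Up to the constant vector (-1, ..., -1), this is the gradient at q of the entropy E, and
  \<open>log_ratio w q \<bullet> q\<close> is E(q) itself.\<close>

definition log_ratio :: "real ^ 'i \<Rightarrow> real ^ 'i \<Rightarrow> real ^ 'i" where
  "log_ratio w q = (\<chi> i. ln (w $ i / q $ i))"

lemma inner_log_ratio: "log_ratio w q \<bullet> x = (\<Sum>i\<in>UNIV. ln (w $ i / q $ i) * x $ i)"
  by (simp add: log_ratio_def inner_vec_def)

text \<open>The function t (c + 1 - ln t) is concave with derivative c - ln t, so its graph lies
  below the tangent at a. The convention \<open>ln 0 = 0\<close> admits b = 0.\<close>

lemma times_ln_tangent:
  fixes a b c :: real
  assumes "0 < a" "0 \<le> b"
  shows "(c - ln a) * (a - b) \<le> a * (c + 1 - ln a) - b * (c + 1 - ln b)"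
proof (cases "b = 0")
  case False
  with assms have "b > 0" by simp
  have "ln (a / b) \<le> a / b - 1"
    using assms \<open>b > 0\<close> by (intro ln_le_minus_one) simp
  then have "b * (ln a - ln b) \<le> a - b"
    using assms \<open>b > 0\<close> by (simp add: ln_div field_simps)
  then show ?thesis by (simp add: algebra_simps)
qed (use assms in \<open>simp add: algebra_simps\<close>)

lemma entropy_maximizer:
  fixes X :: "(real ^ 'i) set" and w :: "real ^ 'i"
  assumes "compact X" "convex X" and nonneg: "\<And>x i. x \<in> X \<Longrightarrow> 0 \<le> x $ i"
    and "y \<in> X" and y: "\<And>i. 0 < y $ i" and w: "\<And>i. 0 < w $ i"
  obtains q where "q \<in> X" "\<And>i. 0 < q $ i" "\<And>x. x \<in> X \<Longrightarrow> log_ratio w q \<bullet> (x - q) \<le> 0"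
proof -
  \<comment> \<open>The summand 1 makes \<open>log_ratio w\<close> the exact gradient of F. On
    points with a fixed coordinate sum, F differs from the entropy by a constant.\<close>
  define F where "F x = (\<Sum>i\<in>UNIV. x $ i * (ln (w $ i) + 1 - ln (x $ i)))" for x :: "real ^ 'i"
  have "continuous_on X F"
  proof -
    have *: "continuous_on X (\<lambda>x. x $ i * ln (x $ i))" for i
      by (rule continuous_on_compose2[OF continuous_on_times_ln])
        (auto intro!: continuous_intros simp: nonneg)
    have "continuous_on X (\<lambda>x. \<Sum>i\<in>UNIV. x $ i * (ln (w $ i) + 1) - x $ i * ln (x $ i))"
      by (intro continuous_intros *)
    then show ?thesis by (simp add: F_def[abs_def] algebra_simps)
  qed
  then obtain q where q: "q \<in> X" "\<And>x. x \<in> X \<Longrightarrow> F x \<le> F q"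
    using continuous_attains_sup[OF \<open>compact X\<close>, of F] \<open>y \<in> X\<close> by blast
  \<comment> \<open>By concavity, t times the slope of F at the moved point towards x is at most its
    gain over F(q), which maximality makes nonpositive. Taking the slope at the moved point avoids
    logarithms of 0.\<close>
  have slope: "(\<Sum>i\<in>UNIV. (ln (w $ i) - ln ((q + t *\<^sub>R (x - q)) $ i)) * (x $ i - q $ i)) \<le> 0"
    if x: "x \<in> X" and t: "0 < t" "t \<le> 1" and pos: "\<And>i. 0 < (q + t *\<^sub>R (x - q)) $ i" for x t
  proof -
    let ?v = "q + t *\<^sub>R (x - q)"
    have "?v \<in> X"
      using convexD_alt[OF \<open>convex X\<close> q(1) x, of t] t by (simp add: algebra_simps)
    have "t * (\<Sum>i\<in>UNIV. (ln (w $ i) - ln (?v $ i)) * (x $ i - q $ i))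
        = (\<Sum>i\<in>UNIV. (ln (w $ i) - ln (?v $ i)) * (?v $ i - q $ i))"
      by (simp add: sum_distrib_left algebra_simps)
    also have "\<dots> \<le> F ?v - F q"
      unfolding F_def sum_subtractf[symmetric]
      using pos nonneg[OF q(1)] by (intro sum_mono times_ln_tangent) auto
    also have "\<dots> \<le> 0" using q(2)[OF \<open>?v \<in> X\<close>] by simp
    finally show ?thesis using t by (simp add: mult_le_0_iff)
  qed
  \<comment> \<open>If q_k = 0, a short step from q towards y makes the k-th slope term arbitrarily
    large through - ln t, while the others stay bounded below; this contradicts
    \<open>slope\<close>.\<close>
  have qpos: "0 < q $ k" for k
  proof (rule ccontr)
    assume "\<not> 0 < q $ k"
    then have qk: "q $ k = 0" using nonneg[OF q(1), of k] by simp
    \<comment> \<open>Lower bounds for the slope terms that are independent of t: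
      \<open>?v $ i\<close> lies between q_i and y_i, and ln is increasing.\<close>
    define c where "c i = (ln (w $ i) - ln (y $ i)) * (y $ i - q $ i)" for i
    \<comment> \<open>For t = exp (- M) the k-th term gains - ln t * y_k = M y_k, which is chosen to
      outweigh the sum of the c_i.\<close>
    define M where "M = (\<bar>\<Sum>i\<in>UNIV. c i\<bar> + 1) / y $ k"
    define t where "t = exp (- M)"
    have M: "0 < M" "M * y $ k = \<bar>\<Sum>i\<in>UNIV. c i\<bar> + 1"
      using y[of k] by (auto simp: M_def intro!: divide_pos_pos)
    have t: "0 < t" "t \<le> 1" using M by (auto simp: t_def)
    let ?v = "q + t *\<^sub>R (y - q)"
    have v: "?v $ i = (1 - t) * q $ i + t * y $ i" for i by (simp add: algebra_simps)
    have pos: "0 < ?v $ i" for i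
      unfolding v using t y[of i] nonneg[OF q(1), of i] by (intro add_nonneg_pos) auto
    have ci: "c i \<le> (ln (w $ i) - ln (?v $ i)) * (y $ i - q $ i)" for i
    proof (cases "q $ i \<le> y $ i")
      case True
      have "?v $ i \<le> y $ i"
        using mult_left_mono[OF True, of "1 - t"] t unfolding v by (simp add: algebra_simps)
      then show ?thesis
        using True pos[of i] y[of i] by (auto simp: c_def intro!: mult_right_mono)
    next
      case False
      then have "y $ i \<le> ?v $ i"
        using mult_left_mono[of "y $ i" "q $ i" "1 - t"] t unfolding v by (simp add: algebra_simps)
      then show ?thesis
        using False pos[of i] y[of i] by (auto simp: c_def intro!: mult_right_mono_neg)
    qed
    have ck: "c k + M * y $ k = (ln (w $ k) - ln (?v $ k)) * (y $ k - q $ k)"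
      using qk t y[of k] by (simp add: c_def ln_mult t_def algebra_simps)
    have "(\<Sum>i\<in>UNIV. c i) + M * y $ k = (\<Sum>i\<in>UNIV. c i + (if i = k then M * y $ k else 0))"
      by (simp add: sum.distrib)
    also have "\<dots> \<le> (\<Sum>i\<in>UNIV. (ln (w $ i) - ln (?v $ i)) * (y $ i - q $ i))"
      using ci ck by (intro sum_mono) auto
    also have "\<dots> \<le> 0" using slope[OF \<open>y \<in> X\<close> t pos] .
    finally show False using M by linarith
  qed
  have "log_ratio w q \<bullet> (x - q) \<le> 0" if x: "x \<in> X" for x
  proof -
    let ?f = "\<lambda>t. \<Sum>i\<in>UNIV. (ln (w $ i) - ln ((q + t *\<^sub>R (x - q)) $ i)) * (x $ i - q $ i)"
    \<comment> \<open>Since all q_i are positive, the logarithms are continuous at q, and t can tend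
      to 0 in \<open>slope\<close>.\<close>
    have "(?f \<longlongrightarrow> ?f 0) (at_right 0)"
      using qpos by (intro tendsto_intros) (auto simp: less_imp_neq[symmetric])
    moreover have "\<forall>\<^sub>F t in at_right 0. ?f t \<le> 0"
    proof (rule eventually_at_rightI)
      show "?f t \<le> 0" if "t \<in> {0<..<1}" for t
      proof (rule slope[OF x])
        fix i
        have "0 < (1 - t) * q $ i + t * x $ i"
          using that qpos[of i] nonneg[OF x, of i] by (intro add_pos_nonneg) auto
        then show "0 < (q + t *\<^sub>R (x - q)) $ i" by (simp add: algebra_simps)
      qed (use that in auto)
    qed simp
    ultimately have "?f 0 \<le> 0"
      by (rule tendsto_upperbound) simp
    then show ?thesis using qpos w by (simp add: inner_log_ratio ln_div less_imp_neq[symmetric])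
  qed
  with q(1) qpos that show ?thesis by blast
qed

text \<open>Adding the two inequalities bounds the sum of (ln q'_i - ln q_i) (q'_i - q_i) by 0. Each
  term is nonnegative because ln is increasing, and vanishes only if q_i = q'_i.\<close>

lemma entropy_critical_unique:
  fixes q q' w :: "real ^ 'i"
  assumes pos: "\<And>i. 0 < q $ i" "\<And>i. 0 < q' $ i" and w: "\<And>i. 0 < w $ i"
    and "log_ratio w q \<bullet> (q' - q) \<le> 0" "log_ratio w q' \<bullet> (q - q') \<le> 0"
  shows "q = q'"
proof -
  let ?d = "\<lambda>i. (ln (q' $ i) - ln (q $ i)) * (q' $ i - q $ i)"
  have "(\<Sum>i\<in>UNIV. ?d i) = log_ratio w q \<bullet> (q' - q) + log_ratio w q' \<bullet> (q - q')"
    using pos w by (simp add: inner_log_ratio ln_div less_imp_neq[symmetric] sum.distrib[symmetric]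
        algebra_simps)
  then have le: "(\<Sum>i\<in>UNIV. ?d i) \<le> 0" using assms by simp
  have d: "0 \<le> ?d i" for i
    using pos[of i] by (cases "q $ i \<le> q' $ i") (auto intro: mult_nonneg_nonneg mult_nonpos_nonpos)
  then have "?d i = 0" for i
    using le sum_nonneg_eq_0_iff[of UNIV ?d] by (simp add: antisym sum_nonneg)
  then show ?thesis
    using pos by (auto simp: vec_eq_iff)
qed

section \<open>Bounds on multinomial terms\<close>

text \<open>Crude Stirling bound; the induction step amounts to n (ln (n + 1) - ln n) \<le>
  1.\<close>

lemma ln_fact_ge: "real n * ln n - n \<le> ln (fact n)"
proof (induction n)
  case (Suc n)
  show ?case
  proof (cases "n = 0")
    case False
    then have "ln (1 + 1 / real n) \<le> 1 / n"
      by (intro ln_add_one_self_le_self) simp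
    moreover have "1 + 1 / real n = Suc n / n"
      using False by (simp add: field_simps)
    then have "ln (1 + 1 / real n) = ln (Suc n) - ln n"
      using False by (simp add: ln_div)
    ultimately have "ln (Suc n) - ln n \<le> 1 / n"
      by linarith
    then have "n * (ln (Suc n) - ln n) \<le> 1"
      using False by (simp add: field_simps)
    moreover have "ln (fact (Suc n)) = ln (Suc n) + ln (fact n)"
      by (simp add: ln_mult del: of_nat_Suc)
    ultimately show ?thesis using Suc by (simp add: algebra_simps)
  qed simp
qed simp

text \<open>The matching bound, from 1 \<le> (n + 1) (ln (n + 1) - ln n). The excess is logarithmic,
  hence negligible after division by N.\<close>

lemma ln_fact_le: "ln (fact n) \<le> real n * ln n - n + ln (real n + 1) + 1"
proof (cases "n = 0")
  case False
  then have "0 < n" by simp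
  then have "ln (fact n) \<le> real n * ln n - n + ln n + 1"
  proof (induction n rule: nat_induct_non_zero)
    case (Suc n)
    have "ln (n / Suc n) \<le> real n / Suc n - 1"
      using Suc by (intro ln_le_minus_one) simp
    moreover have "ln (n / Suc n) = ln n - ln (Suc n)"
      using Suc by (simp add: ln_div)
    ultimately have "ln n - ln (Suc n) \<le> real n / Suc n - 1"
      by linarith
    then have "1 \<le> Suc n * (ln (Suc n) - ln n)"
      by (simp add: field_simps)
    moreover have "ln (fact (Suc n)) = ln (Suc n) + ln (fact n)"
      by (simp add: ln_mult del: of_nat_Suc)
    ultimately show ?case using Suc by (simp add: algebra_simps)
  qed simp
  moreover have "ln n \<le> ln (real n + 1)" using False by simp
  ultimately show ?thesis by linarith
qed simp

text \<open>The left side is one term in the expansion of the right side, whose terms are all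
  nonnegative. The induction splits off one variable by the binomial theorem.\<close>

lemma multinomial_term_le:
  fixes w :: "'i \<Rightarrow> real" and a :: "'i \<Rightarrow> nat"
  assumes "finite I" "\<And>i. i \<in> I \<Longrightarrow> 0 \<le> w i"
  shows "fact (\<Sum>i\<in>I. a i) / (\<Prod>i\<in>I. fact (a i)) * (\<Prod>i\<in>I. w i ^ a i) \<le> (\<Sum>i\<in>I. w i) ^ (\<Sum>i\<in>I. a i)"
  using assms
proof (induction I rule: finite_induct)
  case (insert j I)
  let ?n = "\<Sum>i\<in>I. a i" and ?s = "\<Sum>i\<in>I. w i"
  have s: "0 \<le> ?s" using insert by (intro sum_nonneg) auto
  have j: "0 \<le> w j" using insert by auto
  have "fact (a j + ?n) / (fact (a j) * (\<Prod>i\<in>I. fact (a i))) * (w j ^ a j * (\<Prod>i\<in>I. w i ^ a i))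
      = fact (a j + ?n) / (fact (a j) * fact ?n) * w j ^ a j
        * (fact ?n / (\<Prod>i\<in>I. fact (a i)) * (\<Prod>i\<in>I. w i ^ a i))"
    by simp
  also have "\<dots> \<le> fact (a j + ?n) / (fact (a j) * fact ?n) * w j ^ a j * ?s ^ ?n"
    using insert j by (intro mult_left_mono) auto
  also have "\<dots> = of_nat ((a j + ?n) choose a j) * w j ^ a j * ?s ^ (a j + ?n - a j)"
    by (simp add: binomial_fact)
  also have "\<dots> \<le> (w j + ?s) ^ (a j + ?n)"
    unfolding binomial_ring
    by (rule member_le_sum[where f = "\<lambda>k. of_nat ((a j + ?n) choose k) * w j ^ k * ?s ^ (a j + ?n - k)"])
      (use s j in auto)
  finally show ?case using insert by simp
qed simp

text \<open>Stirling is applied to each factorial, and the linear terms cancel because the a_i add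
  up to n. Each index costs one logarithmic error, made uniform by a_i \<le> n.\<close>

lemma ln_multinomial_term_ge:
  fixes w :: "'i \<Rightarrow> real" and a :: "'i \<Rightarrow> nat"
  assumes "finite I" and w: "\<And>i. i \<in> I \<Longrightarrow> 0 < w i"
  defines "n \<equiv> \<Sum>i\<in>I. a i"
  shows "n * ln n + (\<Sum>i\<in>I. a i * ln (w i / a i)) - card I * (ln (real n + 1) + 1)
    \<le> ln (fact n / (\<Prod>i\<in>I. fact (a i)) * (\<Prod>i\<in>I. w i ^ a i))"
proof -
  have "a i * ln (w i / a i) - (ln (real n + 1) + 1) \<le> a i * ln (w i) - ln (fact (a i)) - a i" if "i \<in> I" for i
  proof -
    have "a i \<le> n" using that \<open>finite I\<close> unfolding n_def by (intro member_le_sum) auto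
    then have "ln (real (a i) + 1) \<le> ln (real n + 1)" by simp
    moreover have "a i * ln (w i / a i) = a i * ln (w i) - a i * ln (a i)"
      using w[OF that] by (cases "a i = 0") (auto simp: ln_div algebra_simps)
    ultimately show ?thesis using ln_fact_le[of "a i"] by linarith
  qed
  then have "(\<Sum>i\<in>I. a i * ln (w i / a i) - (ln (real n + 1) + 1)) \<le> (\<Sum>i\<in>I. a i * ln (w i) - ln (fact (a i)) - a i)"
    by (rule sum_mono)
  then have "(\<Sum>i\<in>I. a i * ln (w i / a i)) - card I * (ln (real n + 1) + 1)
     \<le> (\<Sum>i\<in>I. a i * ln (w i)) - (\<Sum>i\<in>I. ln (fact (a i))) - n"
    by (simp add: sum_subtractf n_def)
  moreover have "ln (fact n / (\<Prod>i\<in>I. fact (a i)) * (\<Prod>i\<in>I. w i ^ a i))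
     = ln (fact n) - (\<Sum>i\<in>I. ln (fact (a i))) + (\<Sum>i\<in>I. a i * ln (w i))"
  proof -
    have "0 < (\<Prod>i\<in>I. w i ^ a i)" "0 < (\<Prod>i\<in>I. fact (a i) :: real)"
      using w by (auto intro!: prod_pos)
    moreover have "ln (\<Prod>i\<in>I. w i ^ a i) = (\<Sum>i\<in>I. a i * ln (w i))"
      using \<open>finite I\<close> by (subst ln_prod) (auto simp: ln_realpow dest: w)
    moreover have "ln (\<Prod>i\<in>I. fact (a i) :: real) = (\<Sum>i\<in>I. ln (fact (a i)))"
      using \<open>finite I\<close> by (subst ln_prod) auto
    ultimately show ?thesis by (simp add: ln_mult_pos ln_div)
  qed
  ultimately show ?thesis using ln_fact_ge[of n] by simp
qed

section \<open>Lattice points of dilated polytopes\<close>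

lemma real_of_int_vec_nth [simp]: "real_of_int_vec \<alpha> $ i = real_of_int (\<alpha> $ i)"
  by (simp add: real_of_int_vec_def)

lemma real_of_int_vec_sum:
  "real_of_int_vec (\<Sum>s\<in>S. of_nat (k s) * \<alpha> s) = (\<Sum>s\<in>S. real (k s) *\<^sub>R real_of_int_vec (\<alpha> s))"
  by (simp add: vec_eq_iff of_nat_index)

text \<open>In a convex combination of integral generators giving x, the coefficients are rounded to
  multiples of 1/N that still sum to 1. The constant depends on the generators only.\<close>

lemma lattice_point_near:
  fixes P :: "(real ^ 'm) set"
  assumes "integral_polytope P"
  obtains C where "0 \<le> C"
    and "\<And>x N. x \<in> P \<Longrightarrow> 0 < N \<Longrightarrow>
      \<exists>\<alpha> y. y \<in> P \<and> real_of_int_vec \<alpha> = real N *\<^sub>R y \<and> norm (y - x) \<le> C / N"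
proof -
  obtain S :: "(int ^ 'm) set" where S: "finite S" "P = convex hull (real_of_int_vec ` S)"
    using assms by (auto simp: integral_polytope_def)
  define V where "V = real_of_int_vec ` S"
  define C where "C = 2 * (\<Sum>v\<in>V. \<Sum>u\<in>V. norm (v - u))"
  have "finite V" using S by (simp add: V_def)
  have "\<exists>\<alpha> y. y \<in> P \<and> real_of_int_vec \<alpha> = real N *\<^sub>R y \<and> norm (y - x) \<le> C / N"
    if xP: "x \<in> P" and "0 < N" for x N
  proof -
    have "\<exists>c. (\<forall>v\<in>V. 0 \<le> c v) \<and> sum c V = 1 \<and> (\<Sum>v\<in>V. c v *\<^sub>R v) = x"
      using xP unfolding S(2) V_def[symmetric] convex_hull_finite[OF \<open>finite V\<close>]
      by simp
    then obtain c where c: "\<And>v. v \<in> V \<Longrightarrow> 0 \<le> c v" "sum c V = 1" "(\<Sum>v\<in>V. c v *\<^sub>R v) = x"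
      by blast
    obtain u where u: "u \<in> V" using c(2) by (metis sum.empty all_not_in_conv zero_neq_one)
    define k where "k v = nat \<lfloor>N * c v\<rfloor>" for v
    have k: "real (k v) \<le> N * c v" "N * c v - 1 \<le> real (k v)" if "v \<in> V" for v
      using c(1)[OF that] unfolding k_def by (simp_all add: of_nat_nat)
    have "(\<Sum>v\<in>V. real (k v)) \<le> (\<Sum>v\<in>V. N * c v)" using k by (intro sum_mono)
    also have "\<dots> = N" using c by (simp add: sum_distrib_left[symmetric])
    finally have kN: "(\<Sum>v\<in>V. k v) \<le> N" by (simp only: of_nat_sum[symmetric] of_nat_le_iff)
    \<comment> \<open>The deficit left by rounding down is given to the single generator u.\<close>
    define l where "l v = k v + (if v = u then N - (\<Sum>v\<in>V. k v) else 0)" for v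
    have sum_l: "(\<Sum>v\<in>V. l v) = N"
      using kN u \<open>finite V\<close> by (simp add: l_def sum.distrib)
    define y where "y = (\<Sum>v\<in>V. (l v / N) *\<^sub>R v)"
    have "(\<Sum>v\<in>V. l v / N) = 1"
      using sum_l \<open>0 < N\<close> by (simp add: sum_divide_distrib[symmetric] of_nat_sum[symmetric] del: of_nat_sum)
    then have y: "y \<in> P"
      using \<open>finite V\<close> S(2) unfolding V_def[symmetric]
      by (auto simp: convex_hull_finite y_def intro!: exI[of _ "\<lambda>v. l v / N"])
    define g where "g = inv_into S (real_of_int_vec :: int ^ 'm \<Rightarrow> _)"
    have g: "real_of_int_vec (g v) = v" if "v \<in> V" for v
      using that unfolding V_def g_def by (rule f_inv_into_f)
    have Ny: "real N *\<^sub>R y = (\<Sum>v\<in>V. real (l v) *\<^sub>R v)"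
      using \<open>0 < N\<close> by (simp add: y_def scaleR_sum_right)
    also have "\<dots> = real_of_int_vec (\<Sum>v\<in>V. of_nat (l v) * g v)"
      by (simp add: real_of_int_vec_sum g)
    finally have lat: "real_of_int_vec (\<Sum>v\<in>V. of_nat (l v) * g v) = real N *\<^sub>R y" ..
    define d where "d v = real (k v) - N * c v" for v
    have d: "\<bar>d v\<bar> \<le> 1" if "v \<in> V" for v using k[OF that] by (simp add: d_def)
    \<comment> \<open>The coefficient differences sum to 0, so u can be subtracted from every v.
      This removes the coefficient of u, the only one whose error may exceed 1.\<close>
    have "(\<Sum>v\<in>V. (real (l v) - N * c v)) = 0"
      using sum_l c(2) by (simp add: sum_subtractf sum_distrib_left[symmetric] of_nat_sum[symmetric] del: of_nat_sum)
    then have "real N *\<^sub>R (y - x) = (\<Sum>v\<in>V. (real (l v) - N * c v) *\<^sub>R v) - (\<Sum>v\<in>V. (real (l v) - N * c v)) *\<^sub>R u"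
      by (simp add: Ny scaleR_diff_right c(3)[symmetric] scaleR_diff_left sum_subtractf scaleR_sum_right)
    also have "\<dots> = (\<Sum>v\<in>V. (real (l v) - N * c v) *\<^sub>R (v - u))"
      unfolding scaleR_diff_right scaleR_sum_left by (rule sum_subtractf[symmetric])
    also have "\<dots> = (\<Sum>v\<in>V. d v *\<^sub>R (v - u))"
      by (intro sum.cong) (auto simp: l_def d_def)
    also have "norm \<dots> \<le> (\<Sum>v\<in>V. norm (v - u))"
      using d by (intro sum_norm_le) (auto intro: mult_left_le_one_le)
    also have "\<dots> \<le> (\<Sum>v\<in>V. \<Sum>u\<in>V. norm (v - u))"
      using u \<open>finite V\<close> by (intro sum_mono member_le_sum) auto
    also have "\<dots> \<le> C" unfolding C_def by (simp add: sum_nonneg)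
    finally have "N * norm (y - x) \<le> C" by (simp only: norm_scaleR abs_of_nat)
    then have "norm (y - x) \<le> C / N" using \<open>0 < N\<close> by (simp add: field_simps)
    with y lat show ?thesis by blast
  qed
  moreover have "0 \<le> C" by (simp add: C_def sum_nonneg)
  ultimately show ?thesis using that by blast
qed

section \<open>Homogeneous coordinates\<close>

lemma sum_UNIV_option: "(\<Sum>i\<in>UNIV. f i) = f None + (\<Sum>j\<in>UNIV. f (Some j))"
  for f :: "'a::finite option \<Rightarrow> 'b::comm_monoid_add"
  by (simp add: UNIV_option_conv sum.reindex)

lemma prod_UNIV_option: "(\<Prod>i\<in>UNIV. f i) = f None * (\<Prod>j\<in>UNIV. f (Some j))"
  for f :: "'a::finite option \<Rightarrow> 'b::comm_monoid_mult"
  by (simp add: UNIV_option_conv prod.reindex)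

text \<open>The slack coordinate turns the scaled simplex into the nonnegative vectors of coordinate
  sum c, so that all its facets are treated alike.\<close>

definition homog :: "real \<Rightarrow> real ^ 'm \<Rightarrow> real ^ 'm option" where
  "homog c x = (\<chi> i. case i of None \<Rightarrow> c - (\<Sum>j\<in>UNIV. x $ j) | Some j \<Rightarrow> x $ j)"

definition weight :: "complex ^ 'm \<Rightarrow> real ^ 'm option" where
  "weight z = (\<chi> i. case i of None \<Rightarrow> 1 | Some j \<Rightarrow> (cmod (z $ j))\<^sup>2)"

lemma homog_nth [simp]:
  "homog c x $ None = c - (\<Sum>j\<in>UNIV. x $ j)" "homog c x $ Some j = x $ j"
  by (simp_all add: homog_def)

lemma weight_nth [simp]: "weight z $ None = 1" "weight z $ Some j = (cmod (z $ j))\<^sup>2"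
  by (simp_all add: weight_def)

lemma option_vec_eq_iff: "x = y \<longleftrightarrow> x $ None = y $ None \<and> (\<forall>j. x $ Some j = y $ Some j)"
  by (metis vec_eq_iff option.exhaust)

lemma sum_homog: "(\<Sum>i\<in>UNIV. homog c x $ i) = c"
  by (simp add: sum_UNIV_option)

lemma homog_inject [simp]: "homog c x = homog c y \<longleftrightarrow> x = y"
  by (metis homog_nth(2) vec_eq_iff)

lemma homog_affine:
  "u + v = 1 \<Longrightarrow> homog c (u *\<^sub>R x + v *\<^sub>R y) = u *\<^sub>R homog c x + v *\<^sub>R homog c y"
  by (simp add: option_vec_eq_iff sum.distrib sum_distrib_left[symmetric] right_diff_distrib,
      metis distrib_right mult_1)

lemma homog_scaleR: "homog (k * c) (k *\<^sub>R x) = k *\<^sub>R homog c x"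
  by (simp add: option_vec_eq_iff sum_distrib_left[symmetric] right_diff_distrib)

lemma continuous_on_homog: "continuous_on A (homog c)"
proof -
  have "continuous_on A (\<lambda>x. case i of None \<Rightarrow> c - (\<Sum>j\<in>UNIV. x $ j) | Some j \<Rightarrow> x $ j)" for i
    by (cases i) (auto intro!: continuous_intros)
  then show ?thesis unfolding homog_def[abs_def] by (intro continuous_intros)
qed

lemma weight_pos: "z \<in> complex_torus \<Longrightarrow> 0 < weight z $ i"
  by (cases i) (auto simp: complex_torus_def)

lemma mem_dilate_simplex_iff:
  assumes "0 < p"
  shows "x \<in> dilate p unit_simplex \<longleftrightarrow> (\<forall>i. 0 \<le> homog p x $ i)"
proof
  assume "x \<in> dilate p unit_simplex"
  then obtain y where y: "y \<in> unit_simplex" "x = real p *\<^sub>R y" by (auto simp: dilate_def)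
  then have "homog p x = real p *\<^sub>R homog 1 y" using homog_scaleR[of p 1 y] by simp
  moreover have "0 \<le> homog 1 y $ i" for i using y by (cases i) (auto simp: unit_simplex_def)
  ultimately show "\<forall>i. 0 \<le> homog p x $ i" by simp
next
  assume *: "\<forall>i. 0 \<le> homog p x $ i"
  have "(1 / real p) *\<^sub>R x \<in> unit_simplex"
    using *[rule_format, of None] *[rule_format, of "Some j" for j] assms
    by (auto simp: unit_simplex_def sum_divide_distrib[symmetric])
  moreover have "x = real p *\<^sub>R (1 / real p) *\<^sub>R x" using assms by simp
  ultimately show "x \<in> dilate p unit_simplex" unfolding dilate_def by blast
qed

text \<open>A ball around x stays in the simplex, so x can be moved along an axis to lower the
  coordinate i by e/2 without making it negative.\<close>

lemma homog_pos_of_not_frontier: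
  assumes "0 < p" "x \<in> dilate p unit_simplex" "x \<notin> frontier (dilate p unit_simplex)"
  shows "0 < homog p x $ i"
proof -
  let ?D = "dilate p unit_simplex :: (real ^ 'a) set"
  have "x \<in> interior ?D"
    using assms closure_subset[of ?D] by (auto simp: frontier_def)
  then obtain e where e: "0 < e" "ball x e \<subseteq> ?D"
    by (auto simp: mem_interior)
  have mem: "x + t *\<^sub>R axis j 1 \<in> ?D" if "\<bar>t\<bar> < e" for t j
    using that by (intro subsetD[OF e(2)]) (simp add: dist_norm)
  show ?thesis
  proof (cases i)
    case None
    \<comment> \<open>A step up along any axis lowers the slack coordinate; \<open>undefined\<close>
      just names some index.\<close>
    have "0 \<le> homog p (x + (e / 2) *\<^sub>R axis undefined 1) $ None"
      using mem[of "e / 2"] e(1) unfolding mem_dilate_simplex_iff[OF assms(1)] by (simp del: homog_nth)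
    then show ?thesis using None e
      by (simp add: sum.distrib sum_divide_distrib[symmetric] sum_distrib_left[symmetric] axis_def)
  next
    case (Some j)
    have "0 \<le> homog p (x + (- e / 2) *\<^sub>R axis j 1) $ Some j"
      using mem[of "- e / 2"] e(1) unfolding mem_dilate_simplex_iff[OF assms(1)] by (simp del: homog_nth)
    then show ?thesis using Some e by simp
  qed
qed

section \<open>The point \<open>q(z)\<close> and the function \<open>b\<^sub>P\<close>\<close>

text \<open>Gradient at q of the entropy of \<open>homog c x\<close> as a function of x: the slack
  coordinate enters with opposite sign and the constants -1 cancel. At q = q(z) and c = p this will
  be \<tau>_z.\<close>

definition dual_vec :: "real \<Rightarrow> complex ^ 'm \<Rightarrow> real ^ 'm \<Rightarrow> real ^ 'm" where
  "dual_vec c z q = (\<chi> j. log_ratio (weight z) (homog c q) $ Some j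
      - log_ratio (weight z) (homog c q) $ None)"

text \<open>The last term does not involve x, so maximizing over P against \<open>dual_vec\<close>
  is first-order optimality for the entropy.\<close>

lemma inner_dual_vec:
  "dual_vec c z q \<bullet> x = log_ratio (weight z) (homog c q) \<bullet> homog c x
     - c * log_ratio (weight z) (homog c q) $ None"
  by (simp add: inner_vec_def dual_vec_def sum_UNIV_option sum_subtractf sum_distrib_right algebra_simps)

lemma norm_exp_act_sq:
  "(cmod (exp_act ((- 1 / 2) *\<^sub>R \<tau>) z $ j))\<^sup>2 = exp (- \<tau> $ j) * (cmod (z $ j))\<^sup>2"
proof -
  have "(exp (- (\<tau> $ j / 2)))\<^sup>2 = exp (- \<tau> $ j)"
    by (simp add: power2_eq_square exp_add[symmetric])
  then show ?thesis by (simp add: exp_act_def norm_mult power_mult_distrib)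
qed

lemma norm_sq_exp_act:
  "(norm (exp_act ((- 1 / 2) *\<^sub>R \<tau>) z))\<^sup>2 = (\<Sum>j\<in>UNIV. exp (- \<tau> $ j) * (cmod (z $ j))\<^sup>2)"
  by (simp add: norm_vec_def L2_set_def sum_nonneg norm_exp_act_sq[simplified])

text \<open>Acting by \<open>dual_vec\<close> replaces the weights (1, |z_j|^2) by the coordinates
  of \<open>homog c q\<close> divided by the slack one; the second identity is their sum.\<close>

lemma dual_vec_act:
  assumes z: "z \<in> complex_torus" and pos: "\<And>i. 0 < homog c q $ i"
  shows "exp (- dual_vec c z q $ j) * (cmod (z $ j))\<^sup>2 = q $ j / homog c q $ None"
    and "1 + (norm (exp_act ((- 1 / 2) *\<^sub>R dual_vec c z q) z))\<^sup>2 = c / homog c q $ None"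
proof -
  show *: "exp (- dual_vec c z q $ j) * (cmod (z $ j))\<^sup>2 = q $ j / homog c q $ None" for j
    using weight_pos[OF z, of "Some j"] pos[of None] pos[of "Some j"]
    by (simp add: dual_vec_def log_ratio_def exp_diff ln_div)
  have "1 + (norm (exp_act ((- 1 / 2) *\<^sub>R dual_vec c z q) z))\<^sup>2
      = 1 + (\<Sum>j\<in>UNIV. q $ j) / homog c q $ None"
    by (simp only: norm_sq_exp_act * sum_divide_distrib)
  then show "1 + (norm (exp_act ((- 1 / 2) *\<^sub>R dual_vec c z q) z))\<^sup>2 = c / homog c q $ None"
    using pos[of None] by (simp add: field_simps)
qed

text \<open>Eliminates \<tau>: the moment map determines the ratios exp (- \<tau>_j) |z_j|^2 = q_j /
  q_0, and all of these are positive on the torus.\<close>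

lemma moment_map_eq_iff:
  assumes z: "z \<in> complex_torus" and "0 < p"
  shows "real p *\<^sub>R moment_map (exp_act ((- 1 / 2) *\<^sub>R \<tau>) z) = q
    \<longleftrightarrow> (\<forall>i. 0 < homog p q $ i) \<and> \<tau> = dual_vec p z q"
proof
  let ?s = "1 + (norm (exp_act ((- 1 / 2) *\<^sub>R \<tau>) z))\<^sup>2"
  let ?u = "\<lambda>j. exp (- \<tau> $ j) * (cmod (z $ j))\<^sup>2"
  have s: "0 < ?s" by (simp add: add_pos_nonneg)
  have u: "0 < ?u j" for j using weight_pos[OF z, of "Some j"] by simp
  assume *: "real p *\<^sub>R moment_map (exp_act ((- 1 / 2) *\<^sub>R \<tau>) z) = q"
  then have q: "q $ j = p * ?u j / ?s" for j
    by (auto simp: moment_map_def norm_exp_act_sq[simplified])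
  have "(\<Sum>j\<in>UNIV. q $ j) = p * (\<Sum>j\<in>UNIV. ?u j) / ?s"
    by (simp only: q sum_divide_distrib sum_distrib_left)
  also have "(\<Sum>j\<in>UNIV. ?u j) = ?s - 1"
    unfolding norm_sq_exp_act by simp
  finally have "(\<Sum>j\<in>UNIV. q $ j) = p * (?s - 1) / ?s" .
  then have q0: "homog p q $ None = p / ?s"
    using s by (simp add: field_simps)
  have pos: "0 < homog p q $ i" for i
    using q0 q u s \<open>0 < p\<close> by (cases i) (simp_all del: homog_nth(1))
  moreover have "\<tau> $ j = dual_vec p z q $ j" for j
  proof -
    have "exp (- dual_vec p z q $ j) * (cmod (z $ j))\<^sup>2 = ?u j"
      using s \<open>0 < p\<close> by (simp add: dual_vec_act[OF z pos] q q0 del: homog_nth)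
    then show ?thesis using weight_pos[OF z, of "Some j"] by simp
  qed
  ultimately show "(\<forall>i. 0 < homog p q $ i) \<and> \<tau> = dual_vec p z q"
    by (simp add: vec_eq_iff)
next
  assume *: "(\<forall>i. 0 < homog p q $ i) \<and> \<tau> = dual_vec p z q"
  then have pos: "\<And>i. 0 < homog p q $ i" and \<tau>: "\<tau> = dual_vec p z q" by auto
  have "moment_map (exp_act ((- 1 / 2) *\<^sub>R \<tau>) z) $ j
      = q $ j / homog p q $ None / (p / homog p q $ None)" for j
    unfolding \<tau> moment_map_def vec_lambda_beta norm_exp_act_sq dual_vec_act[OF z pos] ..
  then show "real p *\<^sub>R moment_map (exp_act ((- 1 / 2) *\<^sub>R \<tau>) z) = q"
    using pos[of None] \<open>0 < p\<close> by (simp add: vec_eq_iff del: homog_nth)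
qed

text \<open>Compactness bounds the functional on P, so the \<open>SUP\<close> is a genuine
  supremum.\<close>

lemma normal_cone_iff:
  assumes "compact P" "q \<in> P"
  shows "u \<in> normal_cone P q \<longleftrightarrow> (\<forall>y\<in>P. u \<bullet> y \<le> u \<bullet> q)"
proof
  have "bdd_above ((\<bullet>) u ` P)"
    using assms(1) by (intro bounded_imp_bdd_above compact_imp_bounded compact_continuous_image)
      (auto intro!: continuous_intros)
  then show "\<forall>y\<in>P. u \<bullet> y \<le> u \<bullet> q" if "u \<in> normal_cone P q"
    using that by (auto simp: normal_cone_def intro: cSUP_upper)
  show "u \<in> normal_cone P q" if "\<forall>y\<in>P. u \<bullet> y \<le> u \<bullet> q"
    using that assms(2) by (auto simp: normal_cone_def intro!: cSup_eq_maximum[symmetric])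
qed

text \<open>Once \<tau> is eliminated, the defining conditions say that q has positive homogeneous
  coordinates and is first-order optimal for the entropy on P. Such a q exists as a maximizer and is
  unique.\<close>

lemma q_tau_characterization:
  fixes P :: "(real ^ 'm) set"
  assumes "0 < p" "compact P" "convex P" "P \<subseteq> dilate p unit_simplex"
    and "\<not> P \<subseteq> frontier (dilate p unit_simplex)" and z: "z \<in> complex_torus"
  shows "q_point P p z \<in> P" (is ?A)
    and "0 < homog p (q_point P p z) $ i" (is ?B)
    and "y \<in> P \<Longrightarrow> log_ratio (weight z) (homog p (q_point P p z)) \<bullet> homog p y
      \<le> log_ratio (weight z) (homog p (q_point P p z)) \<bullet> homog p (q_point P p z)" (is "_ \<Longrightarrow> ?C")
    and "tau P p z = dual_vec p z (q_point P p z)" (is ?D)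
proof -
  let ?L = "\<lambda>q. log_ratio (weight z) (homog p q)"
  let ?R = "\<lambda>q. q \<in> P \<and> (\<forall>i. 0 < homog p q $ i) \<and> (\<forall>y\<in>P. ?L q \<bullet> (homog p y - homog p q) \<le> 0)"
  \<comment> \<open>This point has positive homogeneous coordinates, as the maximization argument
    requires of one point.\<close>
  obtain y0 where y0: "y0 \<in> P" "y0 \<notin> frontier (dilate p unit_simplex)" using assms by blast
  have "\<exists>q. ?R q"
  proof -
    have "compact (homog p ` P)"
      by (intro compact_continuous_image continuous_on_homog assms)
    moreover have "convex (homog p ` P)"
    proof (rule convexI)
      fix x y :: "real ^ 'm option" and u v :: real
      assume "x \<in> homog p ` P" "y \<in> homog p ` P" and uv: "0 \<le> u" "0 \<le> v" "u + v = 1"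
      then obtain x' y' where "x' \<in> P" "y' \<in> P" "x = homog p x'" "y = homog p y'" by blast
      then show "u *\<^sub>R x + v *\<^sub>R y \<in> homog p ` P"
        using convexD[OF \<open>convex P\<close> _ _ uv] homog_affine[OF uv(3), of p x' y'] by (metis imageI)
    qed
    moreover have "0 \<le> x $ i" if "x \<in> homog p ` P" for x i
      using that assms mem_dilate_simplex_iff[OF \<open>0 < p\<close>] by blast
    moreover have "0 < homog p y0 $ i" for i
      using homog_pos_of_not_frontier[OF \<open>0 < p\<close> _ y0(2)] y0 assms by blast
    ultimately obtain q where "q \<in> homog p ` P" "\<And>i. 0 < q $ i"
      "\<And>x. x \<in> homog p ` P \<Longrightarrow> log_ratio (weight z) q \<bullet> (x - q) \<le> 0"
      using entropy_maximizer[of "homog p ` P" "homog p y0" "weight z"] weight_pos[OF z] y0(1)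
      by (metis imageI)
    then show ?thesis by blast
  qed
  then obtain q where q: "?R q" by blast
  have unique: "q' = q" if "?R q'" for q'
    using entropy_critical_unique[of "homog p q'" "homog p q" "weight z"] that q weight_pos[OF z]
    by auto
  \<comment> \<open>Describing all solutions at once gives the existence and uniqueness behind the
    definite description.\<close>
  have *: "(case r of (q, \<tau>) \<Rightarrow> q \<in> P \<and> \<tau> \<in> normal_cone P q \<and>
     real p *\<^sub>R moment_map (exp_act ((- 1 / 2) *\<^sub>R \<tau>) z) = q) \<longleftrightarrow> r = (q, dual_vec p z q)" for r
  proof (cases r)
    case (Pair q' \<tau>)
    have "q' \<in> P \<and> \<tau> \<in> normal_cone P q' \<and> real p *\<^sub>R moment_map (exp_act ((- 1 / 2) *\<^sub>R \<tau>) z) = q'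
      \<longleftrightarrow> ?R q' \<and> \<tau> = dual_vec p z q'"
      unfolding moment_map_eq_iff[OF z \<open>0 < p\<close>]
      by (auto simp: normal_cone_iff[OF \<open>compact P\<close>] inner_dual_vec inner_diff_right)
    also have "\<dots> \<longleftrightarrow> q' = q \<and> \<tau> = dual_vec p z q"
      using q unique by blast
    finally show ?thesis by (simp add: Pair)
  qed
  have "q_tau P p z = (q, dual_vec p z q)"
    unfolding q_tau_def by (rule the_equality) (simp_all only: *)
  then have "q_point P p z = q" "tau P p z = dual_vec p z q"
    by (simp_all add: q_point_def tau_def)
  with q show ?A ?B ?D "y \<in> P \<Longrightarrow> ?C" by (auto simp: inner_diff_right)
qed

text \<open>By \<open>dual_vec_act\<close> the denominator in the logarithm is p / q_0, and the
  resulting p ln q_0 cancels the one in the inner product of q(z) and \<tau>_z.\<close>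

lemma b_fun_eq:
  fixes P :: "(real ^ 'm) set"
  assumes "0 < p" "compact P" "convex P" "P \<subseteq> dilate p unit_simplex"
    and "\<not> P \<subseteq> frontier (dilate p unit_simplex)" and z: "z \<in> complex_torus"
  defines "q \<equiv> homog p (q_point P p z)"
  shows "b_fun P p z = p * ln (1 + (norm z)\<^sup>2) - p * ln p - log_ratio (weight z) q \<bullet> q"
proof -
  note char = q_tau_characterization[OF assms(1-6)]
  have "0 < 1 + (norm z)\<^sup>2" by (simp add: add_pos_nonneg)
  moreover have q: "0 < q $ None" unfolding q_def by (rule char(2))
  ultimately have ln: "ln ((1 + (norm z)\<^sup>2) / (p / q $ None)) = ln (1 + (norm z)\<^sup>2) - ln p + ln (q $ None)"
    using \<open>0 < p\<close> by (simp add: ln_div del: divide_divide_eq_right)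
  show ?thesis
    using q unfolding b_fun_def char(4) dual_vec_act(2)[OF z char(2)] inner_commute[of "q_point P p z"]
      inner_dual_vec q_def[symmetric] ln
    by (simp add: log_ratio_def ln_div algebra_simps)
qed

section \<open>Lattice points as exponent vectors, and the size of single terms\<close>

text \<open>With the slack exponent Np - |\<alpha>| included, a summand of the kernel is an ordinary
  multinomial term in m + 1 variables. Nonnegativity makes the \<open>nat\<close> conversions
  exact.\<close>

lemma lattice_exponents:
  fixes y :: "real ^ 'm" and z :: "complex ^ 'm"
  assumes "0 < p" "y \<in> dilate p unit_simplex" and \<alpha>: "real_of_int_vec \<alpha> = real N *\<^sub>R y"
  obtains a where "\<And>i. real (a i) = N * homog p y $ i" "(\<Sum>i\<in>UNIV. a i) = N * p"
    "multinomial (N * p) \<alpha> * (cmod (monomial z \<alpha>))\<^sup>2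
      = fact (N * p) / (\<Prod>i\<in>UNIV. fact (a i)) * (\<Prod>i\<in>UNIV. weight z $ i ^ a i)"
proof -
  define a where "a i = (case i of None \<Rightarrow> nat (int (N * p) - (\<Sum>j\<in>UNIV. \<alpha> $ j)) | Some j \<Rightarrow> nat (\<alpha> $ j))" for i
  have nonneg: "0 \<le> homog p y $ i" for i
    using assms mem_dilate_simplex_iff by blast
  have \<alpha>_eq: "real_of_int (\<alpha> $ j) = N * y $ j" for j
    using \<alpha> by (simp add: vec_eq_iff)
  have \<alpha>_nonneg: "0 \<le> \<alpha> $ j" for j
    using \<alpha>_eq[of j] nonneg[of "Some j"] by (metis homog_nth(2) mult_nonneg_nonneg of_int_0_le_iff of_nat_0_le_iff)
  have eq0: "real_of_int (int (N * p) - (\<Sum>j\<in>UNIV. \<alpha> $ j)) = N * homog p y $ None"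
    by (simp add: \<alpha>_eq sum_distrib_left right_diff_distrib)
  then have nonneg0: "0 \<le> int (N * p) - (\<Sum>j\<in>UNIV. \<alpha> $ j)"
    using nonneg[of None] by (metis mult_nonneg_nonneg of_int_0_le_iff of_nat_0_le_iff)
  have a: "real (a i) = N * homog p y $ i" for i
  proof (cases i)
    case None
    then show ?thesis using eq0 nonneg0 by (simp add: a_def del: of_int_diff homog_nth)
  next
    case (Some j)
    then show ?thesis using \<alpha>_eq \<alpha>_nonneg by (simp add: a_def)
  qed
  have "real (\<Sum>i\<in>UNIV. a i) = real (N * p)"
    by (simp add: a sum_homog sum_distrib_left[symmetric])
  then have "(\<Sum>i\<in>UNIV. a i) = N * p" by (simp only: of_nat_eq_iff)
  moreover have "(cmod (z $ j powi (\<alpha> $ j)))\<^sup>2 = weight z $ Some j ^ a (Some j)" for j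
    using \<alpha>_nonneg[of j]
    by (simp add: a_def power_int_def norm_power power_mult[symmetric] mult.commute)
  then have "(cmod (monomial z \<alpha>))\<^sup>2 = (\<Prod>i\<in>UNIV. weight z $ i ^ a i)"
    by (simp add: monomial_def prod_norm[symmetric] prod_power_distrib prod_UNIV_option del: weight_nth(2))
  then have "multinomial (N * p) \<alpha> * (cmod (monomial z \<alpha>))\<^sup>2
      = fact (N * p) / (\<Prod>i\<in>UNIV. fact (a i)) * (\<Prod>i\<in>UNIV. weight z $ i ^ a i)"
    by (simp add: multinomial_def prod_UNIV_option a_def)
  ultimately show ?thesis using a that by blast
qed

text \<open>The change of weights from w to q leaves a multinomial term in q, at most c^n, times the
  exponential of a functional linear in the exponents.\<close>

lemma multinomial_term_le_exp:
  fixes a :: "'i::finite \<Rightarrow> nat" and q w :: "real ^ 'i"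
  assumes "\<And>i. 0 < q $ i" "\<And>i. 0 < w $ i" "(\<Sum>i\<in>UNIV. q $ i) = c" "0 < c"
  defines "n \<equiv> (\<Sum>i\<in>UNIV. a i)"
  shows "fact n / (\<Prod>i\<in>UNIV. fact (a i)) * (\<Prod>i\<in>UNIV. w $ i ^ a i)
    \<le> exp (n * ln c + log_ratio w q \<bullet> (\<chi> i. real (a i)))"
proof -
  have "exp (ln (w $ i / q $ i) * a i) = (w $ i / q $ i) ^ a i" for i
    using assms by (metis exp_ln exp_of_nat2_mult divide_pos_pos)
  then have e: "exp (log_ratio w q \<bullet> (\<chi> i. real (a i))) = (\<Prod>i\<in>UNIV. (w $ i / q $ i) ^ a i)"
    by (simp add: inner_log_ratio exp_sum)
  have "(\<Prod>i\<in>UNIV. w $ i ^ a i) = (\<Prod>i\<in>UNIV. q $ i ^ a i) * (\<Prod>i\<in>UNIV. (w $ i / q $ i) ^ a i)"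
    unfolding prod.distrib[symmetric] power_mult_distrib[symmetric]
    using assms(1) by (simp add: less_imp_neq[symmetric])
  then have "fact n / (\<Prod>i\<in>UNIV. fact (a i)) * (\<Prod>i\<in>UNIV. w $ i ^ a i)
      = fact n / (\<Prod>i\<in>UNIV. fact (a i)) * (\<Prod>i\<in>UNIV. q $ i ^ a i) * exp (log_ratio w q \<bullet> (\<chi> i. real (a i)))"
    by (simp add: e)
  also have "\<dots> \<le> c ^ n * exp (log_ratio w q \<bullet> (\<chi> i. real (a i)))"
    using multinomial_term_le[of UNIV "\<lambda>i. q $ i" a] assms
    by (intro mult_right_mono) (auto simp: n_def less_imp_le)
  also have "c ^ n = exp (n * ln c)"
    using \<open>0 < c\<close> by (simp add: exp_of_nat_mult)
  finally show ?thesis by (simp add: exp_add)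
qed

lemma card_int_box_le:
  "finite {\<alpha> :: int ^ 'm. \<forall>j. 0 \<le> \<alpha> $ j \<and> \<alpha> $ j \<le> int n}" (is "finite ?B")
  "card {\<alpha> :: int ^ 'm. \<forall>j. 0 \<le> \<alpha> $ j \<and> \<alpha> $ j \<le> int n} \<le> (n + 1) ^ CARD('m)"
proof -
  let ?F = "PiE (UNIV :: 'm set) (\<lambda>_. {0..int n})"
  have "?B \<subseteq> (\<lambda>f. \<chi> j. f j) ` ?F"
  proof
    fix \<alpha> :: "int ^ 'm" assume "\<alpha> \<in> ?B"
    then show "\<alpha> \<in> (\<lambda>f. \<chi> j. f j) ` ?F"
      by (intro image_eqI[of _ _ "\<lambda>j. \<alpha> $ j"]) auto
  qed
  moreover have "finite ?F" by (intro finite_PiE) auto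
  ultimately show "finite ?B" "card ?B \<le> (n + 1) ^ CARD('m)"
    using card_mono[of "(\<lambda>f. \<chi> j. f j) ` ?F" ?B] card_image_le[of ?F "\<lambda>f. \<chi> j. f j"]
    by (auto simp: finite_subset card_PiE nat_add_distrib)
qed

lemma fact_add_le: "fact (n + m) \<le> fact n * real (n + m) ^ m"
proof (induction m)
  case (Suc m)
  have "fact (n + Suc m) = real (n + Suc m) * fact (n + m)" by simp
  also have "\<dots> \<le> real (n + Suc m) * (fact n * real (n + m) ^ m)"
    using Suc by (intro mult_left_mono) auto
  also have "\<dots> \<le> real (n + Suc m) * (fact n * real (n + Suc m) ^ m)"
    by (intro mult_left_mono power_mono) auto
  finally show ?case by (simp add: mult_ac)
qed simp

section \<open>Uniform continuity of the entropy and bounds on compact sets\<close>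

text \<open>The entropy splits into a part linear in x, with coefficients bounded by R, and the
  terms x_i ln x_i, which do not involve w and are uniformly continuous on [0, c]. Hence d is
  independent of w.\<close>

lemma log_ratio_inner_uniform:
  assumes "0 < e"
  obtains d where "0 < d" "\<And>w x y :: real ^ 'i.
    \<lbrakk>\<And>i. 0 < w $ i; \<And>i. \<bar>ln (w $ i)\<bar> \<le> R; \<And>i. 0 \<le> x $ i \<and> x $ i \<le> c;
     \<And>i. 0 \<le> y $ i \<and> y $ i \<le> c; \<And>i. \<bar>y $ i - x $ i\<bar> < d\<rbrakk> \<Longrightarrow>
    \<bar>log_ratio w y \<bullet> y - log_ratio w x \<bullet> x\<bar> < e"
proof -
  define k where "k = real CARD('i)"
  have "0 < k" by (simp add: k_def)
  have "uniformly_continuous_on {0..c} (\<lambda>x. x * ln x)"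
    by (intro compact_uniformly_continuous continuous_on_subset[OF continuous_on_times_ln]) auto
  then obtain d1 where d1: "0 < d1" "\<And>s t. s \<in> {0..c} \<Longrightarrow> t \<in> {0..c} \<Longrightarrow> \<bar>t - s\<bar> < d1 \<Longrightarrow>
      \<bar>t * ln t - s * ln s\<bar> < e / (2 * k)"
    using \<open>0 < e\<close> \<open>0 < k\<close> unfolding uniformly_continuous_on_def dist_real_def
    by (metis divide_pos_pos mult_pos_pos zero_less_numeral)
  \<comment> \<open>Gives the linear part at most e / (2 k) per coordinate;
    \<open>\<bar>R\<bar> + 1\<close> keeps the denominator positive.\<close>
  define d2 where "d2 = e / (2 * k * (\<bar>R\<bar> + 1))"
  have d2: "0 < d2" using \<open>0 < e\<close> \<open>0 < k\<close> by (simp add: d2_def)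
  show ?thesis
  proof (rule that[of "min d1 d2"])
    fix w x y :: "real ^ 'i"
    assume w: "\<And>i. 0 < w $ i" "\<And>i. \<bar>ln (w $ i)\<bar> \<le> R"
      and x: "\<And>i. 0 \<le> x $ i \<and> x $ i \<le> c" and y: "\<And>i. 0 \<le> y $ i \<and> y $ i \<le> c"
      and xy: "\<And>i. \<bar>y $ i - x $ i\<bar> < min d1 d2"
    have split: "log_ratio w v \<bullet> v = (\<Sum>i\<in>UNIV. ln (w $ i) * v $ i - v $ i * ln (v $ i))"
      if "\<And>i. 0 \<le> v $ i" for v
      unfolding inner_log_ratio
    proof (intro sum.cong refl)
      fix i
      show "ln (w $ i / v $ i) * v $ i = ln (w $ i) * v $ i - v $ i * ln (v $ i)"
        using that[of i] w(1)[of i] by (cases "v $ i = 0") (auto simp: ln_div algebra_simps)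
    qed
    have bound: "\<bar>(ln (w $ i) * y $ i - y $ i * ln (y $ i)) - (ln (w $ i) * x $ i - x $ i * ln (x $ i))\<bar> < e / k" for i
    proof -
      have "\<bar>ln (w $ i) * (y $ i - x $ i)\<bar> \<le> (\<bar>R\<bar> + 1) * d2"
        using w(2)[of i] xy[of i] unfolding abs_mult by (intro mult_mono) auto
      also have "\<dots> = e / (2 * k)" by (simp add: d2_def add_nonneg_eq_0_iff)
      finally have "\<bar>ln (w $ i) * y $ i - ln (w $ i) * x $ i\<bar> \<le> e / (2 * k)"
        by (simp add: right_diff_distrib)
      moreover have "\<bar>y $ i * ln (y $ i) - x $ i * ln (x $ i)\<bar> < e / (2 * k)"
        using xy[of i] x[of i] y[of i] by (intro d1(2)) auto
      moreover have "e / k = e / (2 * k) + e / (2 * k)" by (simp add: field_simps)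
      ultimately show ?thesis by linarith
    qed
    have "\<bar>log_ratio w y \<bullet> y - log_ratio w x \<bullet> x\<bar>
      \<le> (\<Sum>i\<in>UNIV. \<bar>(ln (w $ i) * y $ i - y $ i * ln (y $ i)) - (ln (w $ i) * x $ i - x $ i * ln (x $ i))\<bar>)"
      using x y by (simp add: split sum_subtractf[symmetric])
    also have "\<dots> < (\<Sum>i\<in>(UNIV :: 'i set). e / k)"
      using bound by (intro sum_strict_mono) auto
    also have "\<dots> = e" using \<open>0 < k\<close> by (simp add: k_def)
    finally show "\<bar>log_ratio w y \<bullet> y - log_ratio w x \<bullet> x\<bar> < e" .
  qed (use d1 d2 in auto)
qed

lemma homog_le:
  assumes "\<And>i. 0 \<le> homog c x $ i"
  shows "homog c x $ i \<le> c"
  using member_le_sum[of i UNIV "\<lambda>i. homog c x $ i"] assms by (simp add: sum_homog)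

lemma homog_diff_le: "\<bar>homog c y $ i - homog c x $ i\<bar> \<le> CARD('m) * norm (y - x)" for x y :: "real ^ 'm"
proof (cases i)
  case None
  have "\<bar>homog c y $ i - homog c x $ i\<bar> = \<bar>\<Sum>j\<in>UNIV. (y - x) $ j\<bar>"
    by (simp add: None sum_subtractf)
  also have "\<dots> \<le> (\<Sum>j\<in>(UNIV :: 'm set). norm (y - x))"
    by (intro order_trans[OF sum_abs] sum_mono component_le_norm_cart)
  finally show ?thesis by simp
next
  case (Some j)
  have "\<bar>homog c y $ i - homog c x $ i\<bar> \<le> 1 * norm (y - x)"
    using component_le_norm_cart[of "y - x" j] by (simp add: Some)
  also have "\<dots> \<le> CARD('m) * norm (y - x)"
    by (intro mult_right_mono) (auto simp: Suc_le_eq)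
  finally show ?thesis .
qed

text \<open>This is where compactness of K enters. Bounding the sum of the absolute values serves
  all indices at once.\<close>

lemma ln_weight_bounded:
  assumes "compact K" "K \<subseteq> complex_torus"
  obtains R where "\<And>z i. z \<in> K \<Longrightarrow> \<bar>ln (weight z $ i)\<bar> \<le> R"
proof -
  have cont: "continuous_on K (\<lambda>z. ln (weight z $ i))" for i
  proof (cases i)
    case (Some j)
    have "z $ j \<noteq> 0" if "z \<in> K" for z using that assms by (auto simp: complex_torus_def)
    then show ?thesis using Some by (auto intro!: continuous_intros)
  qed simp
  have "continuous_on K (\<lambda>z. \<Sum>i\<in>UNIV. \<bar>ln (weight z $ i)\<bar>)"
    by (intro continuous_intros cont)
  then have "bounded ((\<lambda>z. \<Sum>i\<in>UNIV. \<bar>ln (weight z $ i)\<bar>) ` K)"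
    by (intro compact_imp_bounded compact_continuous_image assms)
  then obtain R where R: "\<And>z. z \<in> K \<Longrightarrow> (\<Sum>i\<in>UNIV. \<bar>ln (weight z $ i)\<bar>) \<le> R"
    unfolding bounded_iff by (auto simp: sum_nonneg)
  have "\<bar>ln (weight z $ i)\<bar> \<le> R" if "z \<in> K" for z i
    using member_le_sum[of i UNIV "\<lambda>i. \<bar>ln (weight z $ i)\<bar>"] R[OF that] by simp
  then show ?thesis using that by blast
qed

lemma integral_polytope_compact_convex:
  assumes "integral_polytope P"
  shows "compact P" "convex P"
  using assms by (auto simp: integral_polytope_def finite_imp_compact_convex_hull)

section \<open>The lattice sum of the kernel\<close>

definition lattice_sum :: "(real ^ 'm) set \<Rightarrow> nat \<Rightarrow> nat \<Rightarrow> complex ^ 'm \<Rightarrow> real" where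
  "lattice_sum P p N z = (\<Sum>\<alpha> | real_of_int_vec \<alpha> \<in> dilate N P.
     multinomial (N * p) \<alpha> * (cmod (monomial z \<alpha>))\<^sup>2)"

lemma multinomial_nonneg: "0 \<le> multinomial k \<alpha>"
  by (auto simp: multinomial_def intro!: prod_nonneg divide_nonneg_nonneg mult_nonneg_nonneg)

lemma card_lattice_points:
  fixes P :: "(real ^ 'm) set"
  assumes "0 < p" "P \<subseteq> dilate p unit_simplex"
  shows "finite {\<alpha>. real_of_int_vec \<alpha> \<in> dilate N P}" (is "finite ?A")
    and "card {\<alpha>. real_of_int_vec \<alpha> \<in> dilate N P} \<le> (N * p + 1) ^ CARD('m)"
proof -
  have "?A \<subseteq> {\<alpha>. \<forall>j. 0 \<le> \<alpha> $ j \<and> \<alpha> $ j \<le> int (N * p)}"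
  proof safe
    fix \<alpha> j assume "real_of_int_vec \<alpha> \<in> dilate N P"
    then obtain y where y: "y \<in> P" "real_of_int_vec \<alpha> = real N *\<^sub>R y" by (auto simp: dilate_def)
    have nonneg: "\<And>i. 0 \<le> homog p y $ i"
      using y assms mem_dilate_simplex_iff[OF assms(1)] by blast
    have "real_of_int (\<alpha> $ j) = N * y $ j" using y(2) by (simp add: vec_eq_iff)
    moreover have "0 \<le> y $ j" "y $ j \<le> p"
      using nonneg[of "Some j"] homog_le[OF nonneg, of "Some j"] by auto
    ultimately have "0 \<le> real_of_int (\<alpha> $ j)" "real_of_int (\<alpha> $ j) \<le> real_of_int (int (N * p))"
      by (auto intro: mult_left_mono)
    then show "0 \<le> \<alpha> $ j" "\<alpha> $ j \<le> int (N * p)"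
      by (simp_all only: of_int_le_iff of_int_0_le_iff)
  qed
  then show "finite ?A" "card ?A \<le> (N * p + 1) ^ CARD('m)"
    using card_int_box_le[where 'm = 'm and n = "N * p"] by (auto intro: finite_subset order_trans[OF card_mono])
qed

text \<open>Optimality of q bounds all terms by the same exponential, and the number of terms is
  polynomial in N.\<close>

lemma lattice_sum_le:
  fixes P :: "(real ^ 'm) set"
  assumes "0 < p" "P \<subseteq> dilate p unit_simplex" and z: "z \<in> complex_torus"
    and q: "\<And>i. 0 < homog p q $ i"
    and max: "\<And>y. y \<in> P \<Longrightarrow> log_ratio (weight z) (homog p q) \<bullet> homog p y
        \<le> log_ratio (weight z) (homog p q) \<bullet> homog p q"
  shows "lattice_sum P p N z \<le> real (N * p + 1) ^ CARD('m) *
    exp (N * (p * ln p + log_ratio (weight z) (homog p q) \<bullet> homog p q))"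
proof -
  let ?L = "log_ratio (weight z) (homog p q)"
  have "multinomial (N * p) \<alpha> * (cmod (monomial z \<alpha>))\<^sup>2 \<le> exp (N * (p * ln p + ?L \<bullet> homog p q))"
    if "real_of_int_vec \<alpha> \<in> dilate N P" for \<alpha>
  proof -
    obtain y where y: "y \<in> P" "real_of_int_vec \<alpha> = real N *\<^sub>R y"
      using \<open>real_of_int_vec \<alpha> \<in> _\<close> by (auto simp: dilate_def)
    then obtain a where a: "\<And>i. real (a i) = N * homog p y $ i" "(\<Sum>i\<in>UNIV. a i) = N * p"
      and eq: "multinomial (N * p) \<alpha> * (cmod (monomial z \<alpha>))\<^sup>2
        = fact (N * p) / (\<Prod>i\<in>UNIV. fact (a i)) * (\<Prod>i\<in>UNIV. weight z $ i ^ a i)"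
      using lattice_exponents[OF \<open>0 < p\<close>, of y \<alpha> N z] assms(2) by blast
    have "(\<chi> i. real (a i)) = real N *\<^sub>R homog p y"
      by (simp add: vec_eq_iff a)
    then have "multinomial (N * p) \<alpha> * (cmod (monomial z \<alpha>))\<^sup>2
      \<le> exp (real (N * p) * ln p + N * (?L \<bullet> homog p y))"
      using multinomial_term_le_exp[OF q weight_pos[OF z] sum_homog, of a] \<open>0 < p\<close>
      by (simp add: eq a(2))
    also have "\<dots> \<le> exp (real (N * p) * ln p + N * (?L \<bullet> homog p q))"
      using max[OF y(1)] by (simp add: mult_left_mono)
    finally show ?thesis by (simp add: algebra_simps)
  qed
  then have "lattice_sum P p N z \<le> card {\<alpha>. real_of_int_vec \<alpha> \<in> dilate N P} *
      exp (N * (p * ln p + ?L \<bullet> homog p q))"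
    unfolding lattice_sum_def by (intro sum_bounded_above) auto
  also have "real (card {\<alpha>. real_of_int_vec \<alpha> \<in> dilate N P}) \<le> real (N * p + 1) ^ CARD('m)"
    using card_lattice_points(2)[OF assms(1,2), of N] by (simp only: of_nat_power[symmetric] of_nat_le_iff)
  finally show ?thesis by (simp add: mult_right_mono)
qed

text \<open>All terms are nonnegative, so the term at \<alpha> alone bounds the sum from below;
  Stirling evaluates it.\<close>

lemma lattice_sum_ge:
  fixes P :: "(real ^ 'm) set"
  assumes "0 < p" "P \<subseteq> dilate p unit_simplex" and z: "z \<in> complex_torus" and "0 < N"
    and y: "y \<in> P" "real_of_int_vec \<alpha> = real N *\<^sub>R y"
  shows "0 < lattice_sum P p N z"
    and "N * (p * ln p + log_ratio (weight z) (homog p y) \<bullet> homog p y)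
      - (CARD('m) + 1) * (ln (real (N * p) + 1) + 1) \<le> ln (lattice_sum P p N z)"
proof -
  let ?t = "multinomial (N * p) \<alpha> * (cmod (monomial z \<alpha>))\<^sup>2"
  obtain a where a: "\<And>i. real (a i) = N * homog p y $ i" "(\<Sum>i\<in>UNIV. a i) = N * p"
    and eq: "?t = fact (N * p) / (\<Prod>i\<in>UNIV. fact (a i)) * (\<Prod>i\<in>UNIV. weight z $ i ^ a i)"
    using lattice_exponents[OF \<open>0 < p\<close>, of y \<alpha> N z] assms by blast
  have t: "0 < ?t"
    unfolding eq by (auto intro!: mult_pos_pos divide_pos_pos prod_pos zero_less_power weight_pos[OF z])
  have "real_of_int_vec \<alpha> \<in> dilate N P" using y by (auto simp: dilate_def)
  then have le: "?t \<le> lattice_sum P p N z"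
    unfolding lattice_sum_def using card_lattice_points(1)[OF assms(1,2)]
    by (intro member_le_sum[where f = "\<lambda>\<alpha>. multinomial (N * p) \<alpha> * (cmod (monomial z \<alpha>))\<^sup>2"])
      (auto simp: multinomial_nonneg)
  with t show "0 < lattice_sum P p N z" by linarith
  have nonneg: "\<And>i. 0 \<le> homog p y $ i"
    using y assms mem_dilate_simplex_iff[OF assms(1)] by blast
  \<comment> \<open>Since a_i = N y_i, a factor N leaves each logarithm. Summed up, this costs N p
    ln N, which Np ln (Np) restores. If the coordinate is 0, both sides are 0.\<close>
  have coord: "a i * ln (weight z $ i / a i) = N * (ln (weight z $ i / homog p y $ i) * homog p y $ i)
      - N * ln N * homog p y $ i" for i
  proof (cases "homog p y $ i = 0")
    case False
    then have "0 < homog p y $ i" using nonneg[of i] by simp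
    then have split: "ln (weight z $ i / (N * homog p y $ i)) = ln (weight z $ i / homog p y $ i) - ln N"
      using \<open>0 < N\<close> weight_pos[OF z, of i] by (simp add: ln_div ln_mult)
    show ?thesis unfolding a split by (simp add: algebra_simps)
  qed (simp add: a)
  have "(\<Sum>i\<in>UNIV. a i * ln (weight z $ i / a i))
     = N * (log_ratio (weight z) (homog p y) \<bullet> homog p y) - N * ln N * p"
    unfolding coord sum_subtractf sum_distrib_left[symmetric] sum_homog inner_log_ratio ..
  moreover have "real (N * p) * ln (real (N * p)) = N * (p * ln p) + N * ln N * p"
    using \<open>0 < N\<close> \<open>0 < p\<close> by (simp add: ln_mult algebra_simps)
  moreover have "real (N * p) * ln (real (N * p)) + (\<Sum>i\<in>UNIV. a i * ln (weight z $ i / a i))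
     - (CARD('m) + 1) * (ln (real (N * p) + 1) + 1) \<le> ln ?t"
    using ln_multinomial_term_ge[of "UNIV :: 'm option set" "\<lambda>i. weight z $ i" a] weight_pos[OF z]
    unfolding a(2) eq by (simp add: card_UNIV_option)
  moreover have "ln ?t \<le> ln (lattice_sum P p N z)" using le t by simp
  ultimately show "N * (p * ln p + log_ratio (weight z) (homog p y) \<bullet> homog p y)
      - (CARD('m) + 1) * (ln (real (N * p) + 1) + 1) \<le> ln (lattice_sum P p N z)"
    by (simp add: distrib_left)
qed

lemma ln_szego_diag:
  fixes P :: "(real ^ 'm) set"
  assumes "0 < lattice_sum P p N z"
  shows "ln (szego_diag P p N z) = ln (fact (N * p + CARD('m)) / fact (N * p)) + ln (lattice_sum P p N z)
    - N * (p * ln (1 + (norm z)\<^sup>2))"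
proof -
  have "0 < 1 + (norm z)\<^sup>2" by (simp add: add_pos_nonneg)
  then show ?thesis
    using assms unfolding szego_diag_def lattice_sum_def[symmetric]
    by (simp add: ln_mult_pos ln_div ln_realpow)
qed

section \<open>The limit\<close>

theorem proposition4p2:
  fixes P :: "(real ^ 'm) set" and p :: nat
  assumes "p > 0"
    and "integral_polytope P"
    and "P \<subseteq> dilate p unit_simplex"
    and "\<not> P \<subseteq> frontier (dilate p unit_simplex)"
  shows "\<forall>K. compact K \<and> K \<subseteq> complex_torus \<longrightarrow>
    uniform_limit K (\<lambda>N z. 1 / real N * ln (szego_diag P p N z))
      (\<lambda>z. - b_fun P p z) sequentially"
proof (intro allI impI, elim conjE)
  fix K :: "(complex ^ 'm) set"
  assume K: "compact K" "K \<subseteq> complex_torus"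
  note polytope = integral_polytope_compact_convex[OF assms(2)]
  note char = q_tau_characterization[OF assms(1) polytope assms(3,4)]
  obtain R where R: "\<And>z i. z \<in> K \<Longrightarrow> \<bar>ln (weight z $ i)\<bar> \<le> R"
    using ln_weight_bounded[OF K] by blast
  obtain C where C: "0 \<le> C"
    "\<And>x N. x \<in> P \<Longrightarrow> 0 < N \<Longrightarrow>
      \<exists>\<alpha> y. y \<in> P \<and> real_of_int_vec \<alpha> = real N *\<^sub>R y \<and> norm (y - x) \<le> C / N"
    using lattice_point_near[OF assms(2)] by blast
  define m where "m = CARD('m)"
  \<comment> \<open>Chosen so that Np + m and Np + 1 are both at most N M.\<close>
  define M where "M = real (p + m + 1)"
  \<comment> \<open>From above, the factorial ratio and the number of terms cost m logarithms each;
    from below, Stirling costs m + 1. The factor 2m + 1 covers both.\<close>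
  define err where "err N = (2 * m + 1) * (ln (real N) / real N) + (2 * m + 1) * (ln M + 1) / real N" for N
  have "1 \<le> M" by (simp add: M_def)
  have "(\<lambda>N. err N) \<longlonglongrightarrow> real (2 * m + 1) * 0 + 0"
    unfolding err_def by (intro tendsto_intros lim_const_over_n)
  then have err_lim: "err \<longlonglongrightarrow> 0" by simp
  show "uniform_limit K (\<lambda>N z. 1 / real N * ln (szego_diag P p N z)) (\<lambda>z. - b_fun P p z) sequentially"
    unfolding uniform_limit_iff
  proof (intro allI impI)
    fix e :: real assume "0 < e"
    then obtain d where d: "0 < d" "\<And>w x y :: real ^ 'm option.
      \<lbrakk>\<And>i. 0 < w $ i; \<And>i. \<bar>ln (w $ i)\<bar> \<le> R; \<And>i. 0 \<le> x $ i \<and> x $ i \<le> p;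
       \<And>i. 0 \<le> y $ i \<and> y $ i \<le> p; \<And>i. \<bar>y $ i - x $ i\<bar> < d\<rbrakk> \<Longrightarrow>
      \<bar>log_ratio w y \<bullet> y - log_ratio w x \<bullet> x\<bar> < e / 2"
      using log_ratio_inner_uniform[of "e / 2" R "real p", where 'i = "'m option"]
      by (metis half_gt_zero)
    have "\<forall>\<^sub>F N in sequentially. err N < e / 2"
      using \<open>0 < e\<close> by (intro order_tendstoD(2)[OF err_lim]) simp
    \<comment> \<open>A lattice approximation within C / N moves each homogeneous coordinate by at
      most m C / N.\<close>
    moreover have "\<forall>\<^sub>F N in sequentially. m * C / real N < d"
      using order_tendstoD(2)[OF lim_const_over_n[of "m * C"]] d(1) by blast
    ultimately show "\<forall>\<^sub>F N in sequentially. \<forall>z\<in>K. dist (1 / real N * ln (szego_diag P p N z)) (- b_fun P p z) < e"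
      using eventually_gt_at_top[of 0]
    proof eventually_elim
      case (elim N)
      have N: "0 < N" by fact
      have mono: "ln (real x) \<le> ln N + ln M" if "0 < x" "x \<le> N * (p + m + 1)" for x
      proof -
        have "real x \<le> N * M"
          using that(2) unfolding M_def by (simp only: of_nat_mult[symmetric] of_nat_le_iff)
        then have "ln (real x) \<le> ln (N * M)"
          using that(1) by simp
        then show ?thesis using N \<open>1 \<le> M\<close> by (simp add: ln_mult)
      qed
      have Nerr: "N * err N = (2 * m + 1) * (ln N + ln M + 1)"
        using N by (simp add: err_def field_simps)
      have lnN: "0 \<le> ln (real N)" "0 \<le> ln M" using N \<open>1 \<le> M\<close> by auto
      have size: "N * p + m \<le> N * (p + m + 1)" "N * p + 1 \<le> N * (p + m + 1)"
        using N mult_le_mono1[of 1 N m] by (auto simp: distrib_left intro: trans_le_add2)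
      show ?case
      proof
        fix z assume "z \<in> K"
        then have z: "z \<in> complex_torus" using K by blast
        define q where "q = q_point P p z"
        let ?L = "\<lambda>x. log_ratio (weight z) (homog p x) \<bullet> homog p x"
        let ?S = "lattice_sum P p N z"
        let ?r = "fact (N * p + m) / fact (N * p) :: real"
        obtain \<alpha> y where y: "y \<in> P" "real_of_int_vec \<alpha> = real N *\<^sub>R y" "norm (y - q) \<le> C / N"
          using C(2)[OF char(1)[OF z] N] unfolding q_def by blast
        note ge = lattice_sum_ge[OF assms(1,3) z N y(1,2)]
        have range: "0 \<le> homog p x $ i \<and> homog p x $ i \<le> p" if "x \<in> P" for x i
          using that assms(1,3) mem_dilate_simplex_iff homog_le by blast
        have L_close: "\<bar>?L y - ?L q\<bar> < e / 2"
        proof (rule d(2))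
          fix i
          have "\<bar>homog p y $ i - homog p q $ i\<bar> \<le> m * (C / N)"
            unfolding m_def using homog_diff_le[of p y i q] y(3)
            by (meson mult_left_mono of_nat_0_le_iff order_trans)
          then show "\<bar>homog p y $ i - homog p q $ i\<bar> < d" using elim by simp
        qed (use weight_pos[OF z] R[OF \<open>z \<in> K\<close>] range y(1) char(1)[OF z] q_def in auto)
        have r1: "1 \<le> ?r" by (simp add: fact_mono)
        have "ln ?r \<le> ln (real (N * p + m) ^ m)"
          using fact_add_le[of "N * p" m] r1 by (intro ln_mono) (auto simp: field_simps)
        also have "\<dots> \<le> m * (ln N + ln M)"
          using mono[OF _ size(1)] assms(1) N by (simp add: ln_realpow mult_left_mono)
        finally have r2: "ln ?r \<le> m * (ln N + ln M)" .
        have "ln ?S \<le> ln (real (N * p + 1) ^ m * exp (N * (p * ln p + ?L q)))"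
          using lattice_sum_le[OF assms(1,3) z char(2,3)[OF z], of N] ge(1)
          unfolding q_def m_def by (intro ln_mono) auto
        also have "\<dots> = m * ln (real (N * p + 1)) + N * (p * ln p + ?L q)"
          by (simp add: ln_mult_pos ln_realpow del: of_nat_add of_nat_mult of_nat_Suc)
        also have "\<dots> \<le> m * (ln N + ln M) + N * (p * ln p + ?L q)"
          using mono[OF _ size(2)] by (intro add_right_mono mult_left_mono) auto
        finally have upper: "ln ?S \<le> m * (ln N + ln M) + N * (p * ln p + ?L q)" .
        have "(m + 1) * (ln (real (N * p) + 1) + 1) \<le> (m + 1) * (ln N + ln M + 1)"
          using mono[OF _ size(2)] by (intro mult_left_mono) (auto simp: add.commute)
        then have lower: "N * (p * ln p + ?L y) - (m + 1) * (ln N + ln M + 1) \<le> ln ?S"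
          using ge(2) unfolding m_def by linarith
        have b: "- b_fun P p z = p * ln p + ?L q - p * ln (1 + (norm z)\<^sup>2)"
          unfolding q_def b_fun_eq[OF assms(1) polytope assms(3,4) z] by simp
        \<comment> \<open>N times the error: the term N p ln (1 + |z|^2) occurs in both the kernel
          and b_P and cancels.\<close>
        define D where "D = ln ?r + ln ?S - N * (p * ln p + ?L q)"
        have D: "1 / real N * ln (szego_diag P p N z) - (- b_fun P p z) = D / N"
          unfolding ln_szego_diag[OF ge(1)] b m_def[symmetric] D_def using N by (simp add: field_simps)
        have "D \<le> (2 * m) * (ln N + ln M)"
          using r2 upper unfolding D_def by (simp add: algebra_simps)
        also have "\<dots> \<le> (2 * m + 1) * (ln N + ln M + 1)"
          using lnN by (intro mult_mono) auto
        finally have D1: "D \<le> N * err N" unfolding Nerr .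
        have "(m + 1) * (ln N + ln M + 1) \<le> (2 * m + 1) * (ln N + ln M + 1)"
          using lnN by (intro mult_right_mono) auto
        moreover have "?L q - ?L y \<le> e / 2" using L_close by linarith
        then have "N * ?L q - N * ?L y \<le> N * (e / 2)"
          unfolding right_diff_distrib[symmetric] by (intro mult_left_mono) auto
        ultimately have D2: "- D \<le> N * err N + N * (e / 2)"
          using lower ln_ge_zero[OF r1] unfolding D_def Nerr distrib_left[of "real N"] by linarith
        have "N * err N + N * (e / 2) < N * e"
          unfolding distrib_left[symmetric] using elim(1) N by (intro mult_strict_left_mono) auto
        moreover have "0 \<le> N * (e / 2)" using \<open>0 < e\<close> by simp
        ultimately have "\<bar>D\<bar> < N * e" using D1 D2 by linarith
        then show "dist (1 / real N * ln (szego_diag P p N z)) (- b_fun P p z) < e"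
          unfolding dist_real_def D using N by (simp add: field_simps)
      qed
    qed
  qed
qed

end
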